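(* Suppose that Assumptions (A1) stability, (A2) strong consistency with regularity, and (A3) boundedness (all spelled out in the context) are satisfied, and let $U_h\subset V_h$ be a linear subspace. Then the saddle-point problem: find $(\varepsilon_h,u_h)\in V_h\times U_h$ such that $$ \begin{cases} (\varepsilon_h,v_h)_{V_h}+b_h(u_h,v_h)=\langle l_h,v_h\rangle_{V_h^\ast\times V_h}, & \forall\, v_h\in V_h,\\ b_h(z_h,\varepsilon_h)=0, & \forall\, z_h\in U_h, \end{cases} $$ has a unique solution $(\varepsilon_h,u_h)\in V_h\times U_h$. Moreover, this solution satisfies the a priori bounds $$ \|\varepsilon_h\|_{V_h}\le \|l_h\|_{V_h^\ast}\qquad\text{and}\qquad \|u_h\|_{V_h}\le \frac{1}{C_{\mathrm{sta}}}\,\|l_h\|_{V_h^\ast}, $$ and the a priori error estimate $$ \|u-u_h\|_{V_h}\le\left(1+\frac{C_{\mathrm{bnd}}}{C_{\mathrm{sta}}}\right)\inf_{z_h\in U_h}\|u-z_h\|_{V_h,\#}, $$ where $u\in X_\#$ is the exact solution of the continuous problem $b(u,v)=\langle l,v\rangle_{Y^\ast,Y}$ for all $v\in Y$.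
   Context: Continuous problem. $X$ and $Y$ are real Banach spaces, $Y$ reflexive, $b$ is a bounded bilinear form on $X\times Y$, and $l\in Y^\ast$. There is a constant $C_b>0$ with $\inf_{0\ne z\in X}\sup_{0\ne y\in Y}\frac{|b(z,y)|}{\|z\|_X\|y\|_Y}\ge C_b$, and $\{y\in Y: b(z,y)=0\ \forall z\in X\}=\{0\}$. Hence there is a unique $u\in X$ such that $b(u,v)=\langle l,v\rangle_{Y^\ast,Y}$ for all $v\in Y$; $u$ is called the exact solution. Discrete setting. $V_h$ is a finite-dimensional real vector space (of functions on a mesh of size $h$; typically piecewise polynomials), not necessarily contained in $X$ or $Y$; $b_h$ is a bilinear form on $V_h\times V_h$ and $l_h$ is a linear form on $V_h$. $V_h$ is equipped with an inner product $(\cdot,\cdot)_{V_h}$ whose induced norm is $\|\cdot\|_{V_h}$. For a linear form $\phi_h:V_h\to\mathbb{R}$, $\|\phi_h\|_{V_h^\ast}:=\sup_{0\ne v_h\in V_h}\frac{\langle\phi_h,v_h\rangle_{V_h^\ast\times V_h}}{\|v_h\|_{V_h}}$. (A1) Stability: there is a constant $C_{\mathrm{sta}}>0$, uniform with respect to the mesh size, such that $\inf_{0\ne z_h\in V_h}\sup_{0\ne v_h\in V_h}\frac{b_h(z_h,v_h)}{\|z_h\|_{V_h}\|v_h\|_{V_h}}\ge C_{\mathrm{sta}}$. (A2) Strong consistency with regularity: the exact solution $u$ belongs to a subspace $X_\#\subset X$ such that the bilinear form $b_h$ extends to $V_{h,\#}\times V_h$, where $V_{h,\#}:=X_\#+V_h$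 (the sum being taken in a common ambient vector space of functions), and $b_h(u,v_h)=\langle l_h,v_h\rangle_{V_h^\ast\times V_h}$ for all $v_h\in V_h$. (A3) Boundedness: the norm $\|\cdot\|_{V_h}$ extends to $V_{h,\#}$, and there is a second norm $\|\cdot\|_{V_h,\#}$ on $V_{h,\#}$ such that (i) $\|v\|_{V_h}\le\|v\|_{V_h,\#}$ for all $v\in V_{h,\#}$; (ii) there is a constant $C_{\mathrm{bnd}}<\infty$, uniform with respect to the mesh size, such that $b_h(z,v_h)\le C_{\mathrm{bnd}}\|z\|_{V_h,\#}\|v_h\|_{V_h}$ for all $(z,v_h)\in V_{h,\#}\times V_h$. *)

theory Defs
  imports "HOL-Analysis.Analysis"
begin

definition reflexive_space :: "'a::real_normed_vector itself \<Rightarrow> bool" where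
  "reflexive_space _ \<longleftrightarrow>
     (\<forall>F :: ('a \<Rightarrow>\<^sub>L real) \<Rightarrow>\<^sub>L real. \<exists>y. \<forall>f. blinfun_apply F f = blinfun_apply f y)"

text \<open>The discrete spaces are linear subspaces of an ambient real vector space that carries no norm
  of its own, so forms and norms on them are functions on the ambient type that are constrained only
  on the relevant subspace.\<close>

definition linear_form_on :: "'w::real_vector set \<Rightarrow> ('w \<Rightarrow> real) \<Rightarrow> bool" where
  "linear_form_on V f \<longleftrightarrow>
     (\<forall>x\<in>V. \<forall>y\<in>V. f (x + y) = f x + f y) \<and> (\<forall>c. \<forall>x\<in>V. f (c *\<^sub>R x) = c * f x)"

definition bilinear_form_on ::
  "'w::real_vector set \<Rightarrow> 'v::real_vector set \<Rightarrow> ('w \<Rightarrow> 'v \<Rightarrow> real) \<Rightarrow> bool" where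
  "bilinear_form_on Z V b \<longleftrightarrow>
     (\<forall>z\<in>Z. linear_form_on V (\<lambda>v. b z v)) \<and> (\<forall>v\<in>V. linear_form_on Z (\<lambda>z. b z v))"

definition inner_product_on :: "'w::real_vector set \<Rightarrow> ('w \<Rightarrow> 'w \<Rightarrow> real) \<Rightarrow> bool" where
  "inner_product_on V p \<longleftrightarrow>
     bilinear_form_on V V p \<and> (\<forall>x\<in>V. \<forall>y\<in>V. p x y = p y x) \<and> (\<forall>x\<in>V. x \<noteq> 0 \<longrightarrow> 0 < p x x)"

definition norm_on :: "'w::real_vector set \<Rightarrow> ('w \<Rightarrow> real) \<Rightarrow> bool" where
  "norm_on V N \<longleftrightarrow>
     (\<forall>x\<in>V. 0 \<le> N x) \<and> (\<forall>x\<in>V. N x = 0 \<longleftrightarrow> x = 0) \<and>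
     (\<forall>c. \<forall>x\<in>V. N (c *\<^sub>R x) = \<bar>c\<bar> * N x) \<and> (\<forall>x\<in>V. \<forall>y\<in>V. N (x + y) \<le> N x + N y)"

text \<open>Extended reals give the infimum and the suprema their usual meaning also for empty or unbounded
  families; in particular the infimum over a trivial first space is \<open>\<infinity>\<close>.\<close>

definition infsup ::
  "'w::real_vector set \<Rightarrow> 'v::real_vector set \<Rightarrow> ('w \<Rightarrow> real) \<Rightarrow> ('v \<Rightarrow> real) \<Rightarrow>
   ('w \<Rightarrow> 'v \<Rightarrow> real) \<Rightarrow> ereal" where
  "infsup Z V NZ NV b = (INF z\<in>Z - {0}. SUP v\<in>V - {0}. ereal (b z v / (NZ z * NV v)))"

text \<open>The case distinction fixes the norm on the dual of the trivial space, where the supremum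
  ranges over the empty set. Otherwise the supremum is a genuine one whenever \<open>V\<close> is
  finite-dimensional and \<open>f\<close> is linear on \<open>V\<close>.\<close>

definition dual_norm :: "'w::real_vector set \<Rightarrow> ('w \<Rightarrow> real) \<Rightarrow> ('w \<Rightarrow> real) \<Rightarrow> real" where
  "dual_norm V N f = (if V = {0} then 0 else (SUP v\<in>V - {0}. f v / N v))"

definition saddle_point_solution ::
  "'w::real_vector set \<Rightarrow> 'w set \<Rightarrow> ('w \<Rightarrow> 'w \<Rightarrow> real) \<Rightarrow> ('w \<Rightarrow> 'w \<Rightarrow> real) \<Rightarrow> ('w \<Rightarrow> real) \<Rightarrow>
   'w \<Rightarrow> 'w \<Rightarrow> bool" where
  "saddle_point_solution V U p b l \<epsilon> w \<longleftrightarrow>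
     \<epsilon> \<in> V \<and> w \<in> U \<and>
     (\<forall>v\<in>V. p \<epsilon> v + b w v = l v) \<and>
     (\<forall>z\<in>U. b z \<epsilon> = 0)"

end

theory Submission
  imports Defs
begin

text \<open>The form \<open>b\<close> turns each \<open>w \<in> U\<close> into a functional on the finite-dimensional inner product
  space \<open>V\<close>, which has a Riesz representative \<open>T w\<close>. In these terms the saddle-point problem says
  that \<open>l\<close> is represented by \<open>\<epsilon> + T w\<close> with \<open>\<epsilon>\<close> orthogonal to \<open>T U\<close>: it asks for the orthogonal
  projection of the representative of \<open>l\<close> onto \<open>T U\<close>. Stability says that \<open>C * \<parallel>w\<parallel> \<le> \<parallel>T w\<parallel>\<close>, so
  \<open>T\<close> is injective, \<open>p (T w) (T z)\<close> is an inner product on \<open>U\<close>, and a second use of the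
  Riesz theorem, now on \<open>U\<close> with that inner product, produces the solution
  (\<open>saddle_point_exists\<close>).

  All the bounds are one estimate (\<open>orthogonal_splitting_bounds\<close>): if the orthogonal sum
  \<open>\<epsilon> + T w\<close> represents a functional of norm at most \<open>M\<close>, then both summands have norm at most
  \<open>M\<close>, hence \<open>\<parallel>\<epsilon>\<parallel> \<le> M\<close> and \<open>\<parallel>w\<parallel> \<le> M / C\<close>. It applies to three functionals. The load gives the
  a priori bounds. The zero functional gives uniqueness. For \<open>z \<in> U\<close>, consistency shows that
  \<open>\<epsilon> + T (w - z)\<close> represents \<open>b (u - z)\<close>, whose norm is at most \<open>C_bnd\<close> times the strong norm of
  \<open>u - z\<close>; the triangle inequality then gives the quasi-optimal error estimate.\<close>

section \<open>Linear forms and inner products on subspaces\<close>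

lemma linear_form_on_zero:
  assumes "linear_form_on V f" "subspace V"
  shows "f 0 = 0"
proof -
  have "f (0 *\<^sub>R 0) = 0 * f 0"
    using assms subspace_0 unfolding linear_form_on_def by blast
  then show ?thesis by simp
qed

lemma linear_form_on_diff:
  assumes "linear_form_on V f" "subspace V" "x \<in> V" "y \<in> V"
  shows "f (x - y) = f x - f y"
proof -
  have "f (x + (- 1) *\<^sub>R y) = f x + f ((- 1) *\<^sub>R y)"
    using assms subspace_scale unfolding linear_form_on_def by blast
  moreover have "f ((- 1) *\<^sub>R y) = - 1 * f y"
    using assms unfolding linear_form_on_def by blast
  ultimately show ?thesis by simp
qed

lemma linear_form_on_subset:
  "linear_form_on V f \<Longrightarrow> W \<subseteq> V \<Longrightarrow> linear_form_on W f"
  unfolding linear_form_on_def by blast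

lemma bilinear_form_on_subset:
  "bilinear_form_on Z V b \<Longrightarrow> Z' \<subseteq> Z \<Longrightarrow> V' \<subseteq> V \<Longrightarrow> bilinear_form_on Z' V' b"
  unfolding bilinear_form_on_def by (meson linear_form_on_subset subsetD)

lemma inner_product_on_subset:
  "inner_product_on V p \<Longrightarrow> W \<subseteq> V \<Longrightarrow> inner_product_on W p"
  unfolding inner_product_on_def by (meson bilinear_form_on_subset subsetD)

lemma subspace_finite_span:
  fixes U :: "'w::real_vector set"
  assumes "subspace U" "U \<subseteq> span B" "finite B"
  obtains B' where "finite B'" "span B' = U"
proof -
  obtain B' where B': "B' \<subseteq> U" "independent B'" "U \<subseteq> span B'"
    using maximal_independent_subset by blast
  have "finite B'"
    using independent_span_bound[OF assms(3) B'(2)] B'(1) assms(2) by blast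
  moreover have "span B' = U"
    using B' assms(1) by (meson span_minimal subset_antisym)
  ultimately show thesis using that by blast
qed

locale inner_product_subspace =
  fixes V :: "'w::real_vector set" and p :: "'w \<Rightarrow> 'w \<Rightarrow> real"
  assumes V: "subspace V" and ip: "inner_product_on V p"
begin

lemma linear_right: "x \<in> V \<Longrightarrow> linear_form_on V (p x)"
  using ip by (simp add: inner_product_on_def bilinear_form_on_def)

lemma sym: "x \<in> V \<Longrightarrow> y \<in> V \<Longrightarrow> p x y = p y x"
  using ip unfolding inner_product_on_def by blast

lemma linear_left: "y \<in> V \<Longrightarrow> linear_form_on V (\<lambda>x. p x y)"
  using ip by (simp add: inner_product_on_def bilinear_form_on_def)

lemma add_left: "x \<in> V \<Longrightarrow> y \<in> V \<Longrightarrow> z \<in> V \<Longrightarrow> p (x + y) z = p x z + p y z"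
  and scale_left: "x \<in> V \<Longrightarrow> z \<in> V \<Longrightarrow> p (c *\<^sub>R x) z = c * p x z"
  using linear_left[of z] unfolding linear_form_on_def by simp_all

lemma add_right: "x \<in> V \<Longrightarrow> y \<in> V \<Longrightarrow> z \<in> V \<Longrightarrow> p z (x + y) = p z x + p z y"
  and scale_right: "x \<in> V \<Longrightarrow> z \<in> V \<Longrightarrow> p z (c *\<^sub>R x) = c * p z x"
  using linear_right[of z] unfolding linear_form_on_def by simp_all

lemma zero: "x \<in> V \<Longrightarrow> p x 0 = 0"
  using linear_form_on_zero[OF linear_right V] .

lemma diff_left: "x \<in> V \<Longrightarrow> y \<in> V \<Longrightarrow> z \<in> V \<Longrightarrow> p (x - y) z = p x z - p y z"
  using linear_form_on_diff[OF linear_left V] .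

lemma diff_right: "x \<in> V \<Longrightarrow> y \<in> V \<Longrightarrow> z \<in> V \<Longrightarrow> p z (x - y) = p z x - p z y"
  using linear_form_on_diff[OF linear_right V] .

lemma pos: "x \<in> V \<Longrightarrow> x \<noteq> 0 \<Longrightarrow> 0 < p x x"
  using ip unfolding inner_product_on_def by blast

lemma nonneg: "x \<in> V \<Longrightarrow> 0 \<le> p x x"
  using pos[of x] zero[of x] by (cases "x = 0") auto

lemma Cauchy_Schwarz:
  assumes x: "x \<in> V" and y: "y \<in> V"
  shows "p x y \<le> sqrt (p x x) * sqrt (p y y)"
proof (cases "y = 0")
  case True
  then show ?thesis using zero[OF x] nonneg[OF x] zero[OF y] by simp
next
  case False
  then have yy: "0 < p y y" using pos y by blast
  define t where "t = p x y / p y y"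
  have ty: "t *\<^sub>R y \<in> V" using V y subspace_scale by blast
  have d: "x - t *\<^sub>R y \<in> V" using V x ty subspace_diff by blast
  have "p (x - t *\<^sub>R y) (x - t *\<^sub>R y) = p x x - 2 * t * p x y + t * (t * p y y)"
    using x y ty d sym[OF y x] by (simp add: diff_left diff_right scale_left scale_right algebra_simps)
  also have "\<dots> = p x x - (p x y)\<^sup>2 / p y y"
    unfolding t_def using yy by (simp add: power2_eq_square)
  finally have "(p x y)\<^sup>2 / p y y \<le> p x x" using nonneg[OF d] by simp
  then have "(p x y)\<^sup>2 \<le> p x x * p y y" using yy by (simp add: pos_divide_le_eq)
  then have "p x y \<le> sqrt (p x x * p y y)" by (rule real_le_rsqrt)
  then show ?thesis by (simp add: real_sqrt_mult)
qed

end

text \<open>Induction on a spanning set: replacing the new vector by its component \<open>a'\<close> orthogonal to the old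
  span, which exists because the old span already represents \<open>p a\<close>, allows the
  representative to be corrected along \<open>a'\<close> without changing its action on the old span.\<close>

lemma Riesz_span:
  fixes B :: "'w::real_vector set"
  assumes "finite B" "inner_product_on (span B) p" "linear_form_on (span B) f"
  shows "\<exists>r\<in>span B. \<forall>v\<in>span B. p r v = f v"
  using assms
proof (induction B arbitrary: f rule: finite_induct)
  case empty
  interpret inner_product_subspace "span {} :: 'w set" p
    using empty by unfold_locales auto
  show ?case using zero[of 0] linear_form_on_zero[OF empty(2)] by simp
next
  case (insert a B)
  interpret inner_product_subspace "span (insert a B)" p
    using insert by unfold_locales auto
  have sub: "span B \<subseteq> span (insert a B)" by (simp add: span_mono subset_insertI)
  have a: "a \<in> span (insert a B)" by (simp add: span_base)
  note IH = insert.IH[OF inner_product_on_subset[OF ip sub]]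
  obtain r where r: "r \<in> span B" "\<forall>v\<in>span B. p r v = f v"
    using IH[OF linear_form_on_subset[OF insert.prems(2) sub]] by blast
  obtain s where s: "s \<in> span B" "\<forall>v\<in>span B. p s v = p a v"
    using IH[OF linear_form_on_subset[OF linear_right[OF a] sub]] by blast
  define a' where "a' = a - s"
  have a': "a' \<in> span (insert a B)" unfolding a'_def using a s(1) sub by (meson span_diff subsetD)
  have orth: "p a' v = 0" if "v \<in> span B" for v
    unfolding a'_def using that s sub a by (simp add: diff_left subsetD)
  \<comment> \<open>If \<open>a' = 0\<close> the quotient is \<open>0\<close>, the correct coefficient since \<open>f a'\<close> vanishes too.\<close>
  define c where "c = f a' / p a' a'"
  have c: "c * p a' a' = f a'"
    unfolding c_def using pos[OF a'] linear_form_on_zero[OF insert.prems(2) V]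
    by (cases "a' = 0") (auto simp: zero[OF a'])
  have rV: "r \<in> span (insert a B)" using r sub by blast
  have ca: "c *\<^sub>R a' \<in> span (insert a B)" using a' by (rule span_scale)
  have "p (r + c *\<^sub>R a') v = f v" if v: "v \<in> span (insert a B)" for v
  proof -
    obtain k where k: "v - k *\<^sub>R a \<in> span B" using v span_breakdown_eq by blast
    define x where "x = v - k *\<^sub>R a + k *\<^sub>R s"
    have x: "x \<in> span B" unfolding x_def using k s(1) by (intro span_add span_scale)
    have xV: "x \<in> span (insert a B)" using x sub by blast
    have ka: "k *\<^sub>R a' \<in> span (insert a B)" using a' by (rule span_scale)
    have ve: "v = x + k *\<^sub>R a'" by (simp add: x_def a'_def algebra_simps)
    have ra: "p r a' = 0" using orth[OF r(1)] sym[OF rV a'] by simp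
    have "p (r + c *\<^sub>R a') v = p r x + k * p r a' + (c * p a' x + k * (c * p a' a'))"
      unfolding ve using rV ca xV ka a'
      by (simp add: add_left add_right scale_left scale_right span_add algebra_simps)
    also have "\<dots> = f x + k * f a'" using r(2) x orth[OF x] ra c by simp
    also have "\<dots> = f v"
      unfolding ve using insert.prems(2) xV ka a' unfolding linear_form_on_def by simp
    finally show ?thesis .
  qed
  moreover have "r + c *\<^sub>R a' \<in> span (insert a B)" using rV ca by (rule span_add)
  ultimately show ?case by blast
qed

section \<open>Stable forms and the saddle-point problem\<close>

locale stable_form = inner_product_subspace V p
  for V :: "'w::real_vector set" and p :: "'w \<Rightarrow> 'w \<Rightarrow> real" +
  fixes N :: "'w \<Rightarrow> real" and b :: "'w \<Rightarrow> 'w \<Rightarrow> real" and C :: real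
  assumes fin: "\<exists>B. finite B \<and> span B = V"
    and N: "v \<in> V \<Longrightarrow> N v = sqrt (p v v)"
    and b: "bilinear_form_on V V b"
    and C: "0 < C"
    and stable: "ereal C \<le> infsup V V N N b"
begin

lemma N_pos: "v \<in> V \<Longrightarrow> v \<noteq> 0 \<Longrightarrow> 0 < N v"
  using pos N by simp

lemma N_nonneg: "v \<in> V \<Longrightarrow> 0 \<le> N v"
  using nonneg N by simp

lemma N_square: "v \<in> V \<Longrightarrow> p v v = N v * N v"
  using nonneg N by simp

lemma Riesz: "linear_form_on V f \<Longrightarrow> \<exists>r\<in>V. \<forall>v\<in>V. p r v = f v"
  using Riesz_span[of _ p f] fin ip by blast

lemma b_right: "z \<in> V \<Longrightarrow> linear_form_on V (b z)"
  and b_left: "v \<in> V \<Longrightarrow> linear_form_on V (\<lambda>z. b z v)"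
  using b unfolding bilinear_form_on_def by blast+

text \<open>The supremum in the inf-sup condition is bounded by the norm of the representative
  divided by \<open>N w\<close>, by the Cauchy--Schwarz inequality.\<close>

lemma stable_representative:
  assumes w: "w \<in> V" and r: "r \<in> V" "\<forall>v\<in>V. p r v = b w v"
  shows "C * N w \<le> N r"
proof (cases "w = 0")
  case True
  then show ?thesis using N[OF w] zero[OF w] N_nonneg[OF r(1)] by simp
next
  case False
  then have Nw: "0 < N w" using N_pos w by blast
  have "ereal C \<le> (SUP v\<in>V - {0}. ereal (b w v / (N w * N v)))"
    using stable w False unfolding infsup_def by (meson Diff_iff INF_lower order_trans singletonD)
  also have "\<dots> \<le> ereal (N r / N w)"
  proof (rule SUP_least)
    fix v assume v: "v \<in> V - {0}"
    then have "0 < N v" using N_pos by blast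
    moreover have "b w v \<le> N r * N v" using Cauchy_Schwarz[of r v] r v N by auto
    ultimately show "ereal (b w v / (N w * N v)) \<le> ereal (N r / N w)"
      using Nw by (simp add: divide_simps mult.commute)
  qed
  finally show ?thesis using Nw by (simp add: pos_le_divide_eq)
qed

text \<open>Pythagoras' theorem for \<open>\<epsilon> + r\<close>, where \<open>r\<close> represents \<open>b w\<close> and is orthogonal to
  \<open>\<epsilon>\<close>: testing the equation with either summand leaves only its own square.\<close>

lemma orthogonal_splitting_bounds:
  assumes e: "\<epsilon> \<in> V" and w: "w \<in> V"
    and eq: "\<And>v. v \<in> V \<Longrightarrow> p \<epsilon> v + b w v = f v" and orth: "b w \<epsilon> = 0"
    and M: "0 \<le> M" and bound: "\<And>v. v \<in> V \<Longrightarrow> f v \<le> M * N v"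
  shows "N \<epsilon> \<le> M" and "N w \<le> M / C"
proof -
  have cancel: "N v \<le> M" if "v \<in> V" "p v v = f v" for v
    using bound[of v] N_square[of v] N_nonneg[of v] M that
    by (cases "N v = 0") auto
  show "N \<epsilon> \<le> M" using cancel[OF e] eq[OF e] orth by simp
  obtain r where r: "r \<in> V" "\<forall>v\<in>V. p r v = b w v" using Riesz[OF b_right[OF w]] by blast
  have "p \<epsilon> r = 0" using sym[OF e r(1)] r(2) e orth by simp
  then have "N r \<le> M" using cancel[OF r(1)] eq[OF r(1)] r by simp
  then have "C * N w \<le> M" using stable_representative[OF w r] by simp
  then show "N w \<le> M / C" using C by (simp add: pos_le_divide_eq mult.commute)
qed

text \<open>Without boundedness of the quotients the real-valued supremum in \<open>dual_norm\<close> would be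
  meaningless; the representative of \<open>f\<close> provides the bound.\<close>

lemma dual_norm_bound:
  assumes f: "linear_form_on V f"
  shows "0 \<le> dual_norm V N f" and "v \<in> V \<Longrightarrow> f v \<le> dual_norm V N f * N v"
proof -
  obtain r where r: "r \<in> V" "\<forall>v\<in>V. p r v = f v" using Riesz[OF f] by blast
  have "f v / N v \<le> N r" if "v \<in> V - {0}" for v
    using Cauchy_Schwarz[of r v] r that N N_pos[of v] by (auto simp: pos_divide_le_eq)
  then have "bdd_above ((\<lambda>v. f v / N v) ` (V - {0}))" by (auto intro!: bdd_aboveI2)
  then have up: "f v / N v \<le> dual_norm V N f" if "v \<in> V - {0}" for v
    using that unfolding dual_norm_def by (auto intro: cSUP_upper)
  show "0 \<le> dual_norm V N f"
  proof (cases "V = {0}")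
    case True
    then show ?thesis by (simp add: dual_norm_def)
  next
    case False
    then obtain v where v: "v \<in> V" "v \<noteq> 0" using V subspace_0 by blast
    have m: "0 - v \<in> V" using V v(1) subspace_0 subspace_diff by blast
    have fm: "f (0 - v) = - f v"
      using linear_form_on_diff[OF f V _ v(1), of 0] subspace_0[OF V] linear_form_on_zero[OF f V]
      by simp
    show ?thesis
    proof (cases "0 \<le> f v")
      case True
      then show ?thesis using up[of v] v N_pos[of v]
        by (meson DiffI divide_nonneg_pos order_trans singletonD)
    next
      case False
      then show ?thesis using up[of "0 - v"] v m N_pos[of "0 - v"] fm
        by (smt (verit) DiffI divide_nonneg_pos right_minus_eq singletonD)
    qed
  qed
  show "f v \<le> dual_norm V N f * N v" if v: "v \<in> V"
  proof (cases "v = 0")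
    case True
    then show ?thesis using linear_form_on_zero[OF f V] N[OF v] zero[OF v] by simp
  next
    case False
    then show ?thesis using up[of v] v N_pos[of v] by (simp add: pos_divide_le_eq)
  qed
qed

text \<open>The second equation says that the error functional \<open>l - b w\<close> vanishes on the
  representatives \<open>T z\<close> of \<open>b z\<close> for \<open>z \<in> U\<close>, that is \<open>p (T w) (T z) = l (T z)\<close>. This is a Riesz
  problem on \<open>U\<close>, so no projection in \<open>V\<close> has to be constructed.\<close>

lemma saddle_point_exists:
  assumes U: "subspace U" "U \<subseteq> V" and l: "linear_form_on V l"
  shows "\<exists>\<epsilon> w. saddle_point_solution V U p b l \<epsilon> w"
proof -
  have "\<forall>z\<in>V. \<exists>r. r \<in> V \<and> (\<forall>v\<in>V. p r v = b z v)" using Riesz b_right by blast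
  then obtain T where T: "\<And>z. z \<in> V \<Longrightarrow> T z \<in> V" "\<And>z v. z \<in> V \<Longrightarrow> v \<in> V \<Longrightarrow> p (T z) v = b z v"
    by metis
  obtain g where g: "g \<in> V" "\<forall>v\<in>V. p g v = l v" using Riesz[OF l] by blast
  define q where "q w z = p (T w) (T z)" for w z
  have q: "q w z = b w (T z)" if "w \<in> U" "z \<in> U" for w z
    unfolding q_def using T that U by auto
  have q_sym: "q w z = q z w" if "w \<in> U" "z \<in> U" for w z
    unfolding q_def using sym[OF T(1) T(1)] that U by auto
  have left: "linear_form_on U (\<lambda>w. q w z)" if z: "z \<in> U" for z
  proof -
    have "linear_form_on U (\<lambda>w. b w (T z))"
      using linear_form_on_subset[OF b_left U(2)] T z U by blast
    then show ?thesis
      unfolding linear_form_on_def using U(1) q[OF _ z] by (auto simp: subspace_add subspace_scale)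
  qed
  have right: "linear_form_on U (q w)" if w: "w \<in> U" for w
    using left[OF w] unfolding linear_form_on_def using U(1) q_sym[OF _ w]
    by (auto simp: subspace_add subspace_scale)
  have "0 < q w w" if w: "w \<in> U" "w \<noteq> 0" for w
  proof -
    have wV: "w \<in> V" using w U by blast
    have "0 < C * N w" using C N_pos[OF wV w(2)] by simp
    also have "\<dots> \<le> N (T w)" using stable_representative[OF wV T(1)[OF wV]] T(2)[OF wV] by blast
    finally show ?thesis unfolding q_def using N[OF T(1)[OF wV]] by simp
  qed
  then have ipq: "inner_product_on U q"
    unfolding inner_product_on_def bilinear_form_on_def using left right q_sym by blast
  obtain B where "finite B" "span B = V" using fin by blast
  then obtain B' where B': "finite B'" "span B' = U" using subspace_finite_span[OF U(1)] U(2) by blast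
  \<comment> \<open>The functional \<open>z \<mapsto> l (T z)\<close>, written so that its linearity is visible.\<close>
  have "linear_form_on U (\<lambda>z. b z g)" using linear_form_on_subset[OF b_left[OF g(1)] U(2)] .
  then obtain w where w: "w \<in> U" "\<forall>z\<in>U. q w z = b z g"
    using Riesz_span[of B' q] B' ipq by blast
  have wV: "w \<in> V" using w U by blast
  define \<epsilon> where "\<epsilon> = g - T w"
  have e: "\<epsilon> \<in> V" unfolding \<epsilon>_def using V g T wV subspace_diff by blast
  have "p \<epsilon> v + b w v = l v" if "v \<in> V" for v
    unfolding \<epsilon>_def using g T wV that by (simp add: diff_left)
  moreover have "b z \<epsilon> = 0" if z: "z \<in> U" for z
  proof -
    have zV: "z \<in> V" using z U by blast
    have "b z \<epsilon> = b z g - b z (T w)"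
      unfolding \<epsilon>_def using linear_form_on_diff[OF b_right[OF zV] V g(1) T(1)[OF wV]] .
    also have "\<dots> = 0" using w(2) z q[OF z w(1)] q_sym[OF z w(1)] by simp
    finally show ?thesis .
  qed
  ultimately show ?thesis unfolding saddle_point_solution_def using e w by blast
qed

lemma saddle_point_unique:
  assumes U: "subspace U" "U \<subseteq> V"
    and s: "saddle_point_solution V U p b l \<epsilon> w" and s': "saddle_point_solution V U p b l \<epsilon>' w'"
  shows "\<epsilon> = \<epsilon>' \<and> w = w'"
proof -
  have m: "\<epsilon> \<in> V" "\<epsilon>' \<in> V" "w \<in> U" "w' \<in> U" "w \<in> V" "w' \<in> V"
    using s s' U unfolding saddle_point_solution_def by auto
  have d: "\<epsilon> - \<epsilon>' \<in> V" "w - w' \<in> U" "w - w' \<in> V"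
    using m U V subspace_diff by blast+
  have eq: "p (\<epsilon> - \<epsilon>') v + b (w - w') v = 0" if v: "v \<in> V" for v
  proof -
    have "p \<epsilon> v + b w v = l v" "p \<epsilon>' v + b w' v = l v"
      using s s' v unfolding saddle_point_solution_def by auto
    then show ?thesis
      using diff_left[OF m(1,2) v] linear_form_on_diff[OF b_left[OF v] V m(5,6)] by linarith
  qed
  have "b (w - w') \<epsilon> = 0" "b (w - w') \<epsilon>' = 0"
    using s s' d unfolding saddle_point_solution_def by auto
  then have "b (w - w') (\<epsilon> - \<epsilon>') = 0"
    using linear_form_on_diff[OF b_right[OF d(3)] V m(1,2)] by simp
  from orthogonal_splitting_bounds[OF d(1,3) eq this, of 0]
  have "N (\<epsilon> - \<epsilon>') \<le> 0" "N (w - w') \<le> 0" by auto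
  then have "\<epsilon> - \<epsilon>' = 0" "w - w' = 0" using N_pos d by fastforce+
  then show ?thesis by simp
qed

lemma saddle_point_bounds:
  assumes "subspace U" "U \<subseteq> V" "linear_form_on V l" "saddle_point_solution V U p b l \<epsilon> w"
  shows "N \<epsilon> \<le> dual_norm V N l" and "N w \<le> dual_norm V N l / C"
proof -
  have *: "\<epsilon> \<in> V" "w \<in> V" "\<And>v. v \<in> V \<Longrightarrow> p \<epsilon> v + b w v = l v" "b w \<epsilon> = 0"
    using assms unfolding saddle_point_solution_def by auto
  show "N \<epsilon> \<le> dual_norm V N l" and "N w \<le> dual_norm V N l / C"
    using orthogonal_splitting_bounds[OF * dual_norm_bound[OF assms(3)]] by auto
qed

text \<open>Subtracting \<open>b z\<close> from the first equation shows that \<open>(\<epsilon>, w - z)\<close> is the splitting of the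
  functional \<open>b (u - z)\<close>, so the residual \<open>\<epsilon>\<close> costs nothing in the constant.\<close>

lemma saddle_point_quasi_optimal:
  assumes U: "subspace U" "U \<subseteq> V" and S: "subspace S" "V \<subseteq> S" "bilinear_form_on S V b"
    and u: "u \<in> S" "\<And>v. v \<in> V \<Longrightarrow> b u v = l v"
    and NS: "norm_on S N" "norm_on S N'" "\<And>v. v \<in> S \<Longrightarrow> N v \<le> N' v"
    and D: "0 \<le> D" "\<And>z v. z \<in> S \<Longrightarrow> v \<in> V \<Longrightarrow> b z v \<le> D * N' z * N v"
    and s: "saddle_point_solution V U p b l \<epsilon> w" and z: "z \<in> U"
  shows "N (u - w) \<le> (1 + D / C) * N' (u - z)"
proof -
  have m: "\<epsilon> \<in> V" "w \<in> V" "w \<in> U" "z \<in> V" "w \<in> S" "z \<in> S"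
    using s z U S unfolding saddle_point_solution_def by auto
  have d: "w - z \<in> V" "w - z \<in> U" "u - z \<in> S" "u - w \<in> S" "w - z \<in> S" "z - w \<in> S"
    using m z U V S u(1) subspace_diff by blast+
  have eq: "p \<epsilon> v + b (w - z) v = b (u - z) v" if v: "v \<in> V" for v
  proof -
    have "p \<epsilon> v + b w v = b u v" using s v u unfolding saddle_point_solution_def by auto
    moreover have lin: "linear_form_on S (\<lambda>x. b x v)"
      using S(3) v unfolding bilinear_form_on_def by blast
    ultimately show ?thesis
      using linear_form_on_diff[OF lin S(1) m(5,6)] linear_form_on_diff[OF lin S(1) u(1) m(6)] by linarith
  qed
  have orth: "b (w - z) \<epsilon> = 0" using s d unfolding saddle_point_solution_def by auto
  have M: "0 \<le> D * N' (u - z)" using D(1) NS(2) d unfolding norm_on_def by simp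
  have "N (w - z) \<le> D * N' (u - z) / C"
    using orthogonal_splitting_bounds(2)[OF m(1) d(1) eq orth M D(2)[OF d(3)]] by simp
  moreover have "N (z - w) = N (w - z)"
  proof -
    have "N ((- 1) *\<^sub>R (w - z)) = \<bar>- 1\<bar> * N (w - z)" using NS(1) d(5) unfolding norm_on_def by blast
    then show ?thesis by simp
  qed
  moreover have "N ((u - z) + (z - w)) \<le> N (u - z) + N (z - w)"
    using NS(1) d(3,6) unfolding norm_on_def by blast
  moreover have "N (u - z) \<le> N' (u - z)" using NS(3) d(3) .
  ultimately show ?thesis by (simp add: algebra_simps)
qed

end

section \<open>Well-posedness and error estimate\<close>

theorem theorem2:
  fixes b :: "'x::banach \<Rightarrow> 'y::banach \<Rightarrow> real"
    and l :: "'y \<Rightarrow>\<^sub>L real"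
    and C\<^sub>b :: real
    and u :: 'x
    and X\<^sub>s :: "'x set"
    and j :: "'x \<Rightarrow> 'w::real_vector"
    and V V\<^sub>s :: "'h \<Rightarrow> 'w set"
    and b\<^sub>h ip :: "'h \<Rightarrow> 'w \<Rightarrow> 'w \<Rightarrow> real"
    and l\<^sub>h N N\<^sub>s :: "'h \<Rightarrow> 'w \<Rightarrow> real"
    and C_sta C_bnd :: real
    and h :: 'h
    and U :: "'w set"
  \<comment> \<open>continuous problem and its exact solution\<close>
  assumes "reflexive_space TYPE('y)"
    and "bounded_bilinear b"
    and "C\<^sub>b > 0"
    and "infsup UNIV UNIV norm norm (\<lambda>z y. \<bar>b z y\<bar>) \<ge> ereal C\<^sub>b"
    and "{y. \<forall>z. b z y = 0} = {0}"
    and "\<forall>v. b u v = blinfun_apply l v"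
  \<comment> \<open>common ambient space: \<open>j\<close> identifies \<open>'x\<close> with a subspace of \<open>'w\<close>\<close>
    and "linear j" and "inj j"
    and "subspace X\<^sub>s"
    and "\<And>k. V\<^sub>s k = j ` X\<^sub>s + V k"
  \<comment> \<open>discrete setting; \<open>'h\<close> indexes the meshes, and the constants do not depend on the index\<close>
    and "\<And>k. subspace (V k)" and "\<And>k. \<exists>B. finite B \<and> span B = V k"
    and "\<And>k. inner_product_on (V k) (ip k)"
    and "\<And>k v. v \<in> V k \<Longrightarrow> N k v = sqrt (ip k v v)"
    and "\<And>k. linear_form_on (V k) (l\<^sub>h k)"
  \<comment> \<open>stability\<close>
    and "C_sta > 0"
    and "\<And>k. infsup (V k) (V k) (N k) (N k) (b\<^sub>h k) \<ge> ereal C_sta"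
  \<comment> \<open>strong consistency with regularity; \<open>b\<^sub>h k\<close> denotes the form and its extension\<close>
    and "u \<in> X\<^sub>s"
    and "\<And>k. bilinear_form_on (V\<^sub>s k) (V k) (b\<^sub>h k)"
    and "\<And>k v. v \<in> V k \<Longrightarrow> b\<^sub>h k (j u) v = l\<^sub>h k v"
  \<comment> \<open>boundedness; \<open>N k\<close> denotes the discrete norm and its extension\<close>
    and "\<And>k. norm_on (V\<^sub>s k) (N k)" and "\<And>k. norm_on (V\<^sub>s k) (N\<^sub>s k)"
    and "\<And>k v. v \<in> V\<^sub>s k \<Longrightarrow> N k v \<le> N\<^sub>s k v"
    and "C_bnd \<ge> 0"
    and "\<And>k z v. z \<in> V\<^sub>s k \<Longrightarrow> v \<in> V k \<Longrightarrow> b\<^sub>h k z v \<le> C_bnd * N\<^sub>s k z * N k v"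
  \<comment> \<open>trial space\<close>
    and "subspace U" and "U \<subseteq> V h"
  shows "(\<exists>!(\<epsilon>, w). saddle_point_solution (V h) U (ip h) (b\<^sub>h h) (l\<^sub>h h) \<epsilon> w) \<and>
    (\<forall>\<epsilon> w. saddle_point_solution (V h) U (ip h) (b\<^sub>h h) (l\<^sub>h h) \<epsilon> w \<longrightarrow>
       N h \<epsilon> \<le> dual_norm (V h) (N h) (l\<^sub>h h) \<and>
       N h w \<le> 1 / C_sta * dual_norm (V h) (N h) (l\<^sub>h h) \<and>
       N h (j u - w) \<le> (1 + C_bnd / C_sta) * (INF z\<in>U. N\<^sub>s h (j u - z)))"
proof -
  let ?V = "V h" and ?S = "V\<^sub>s h" and ?N = "N h" and ?b = "b\<^sub>h h" and ?l = "l\<^sub>h h"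
  have jX: "subspace (j ` X\<^sub>s)" using assms(7,9) by (rule linear_subspace_image)
  have S: "subspace ?S"
  proof -
    have "?S = {x + y |x y. x \<in> j ` X\<^sub>s \<and> y \<in> ?V}" unfolding assms(10) set_plus_def by blast
    then show ?thesis using subspace_sums[OF jX assms(11)] by simp
  qed
  have VS: "?V \<subseteq> ?S"
    unfolding assms(10) using set_plus_intro[OF subspace_0[OF jX]] by fastforce
  have uS: "j u \<in> ?S"
    unfolding assms(10)
    using set_plus_intro[OF imageI[OF assms(18)] subspace_0[OF assms(11)], of j h] by simp
  have lf: "linear_form_on ?V ?l" by (rule assms(15))
  interpret stable_form ?V "ip h" ?N ?b C_sta
    using assms(11)[of h] assms(12)[of h] assms(13)[of h] assms(14)[of _ h] assms(16) assms(17)[of h]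
      bilinear_form_on_subset[OF assms(19)[of h] VS subset_refl]
    by unfold_locales auto
  note U = assms(26,27)
  have "\<exists>!(\<epsilon>, w). saddle_point_solution ?V U (ip h) ?b ?l \<epsilon> w"
  proof -
    obtain \<epsilon> w where s: "saddle_point_solution ?V U (ip h) ?b ?l \<epsilon> w"
      using saddle_point_exists[OF U lf] by blast
    show ?thesis
    proof (rule ex1I[of _ "(\<epsilon>, w)"])
      show "case (\<epsilon>, w) of (\<epsilon>, w) \<Rightarrow> saddle_point_solution ?V U (ip h) ?b ?l \<epsilon> w"
        using s by simp
      show "x = (\<epsilon>, w)"
        if "case x of (\<epsilon>, w) \<Rightarrow> saddle_point_solution ?V U (ip h) ?b ?l \<epsilon> w" for x
        using that saddle_point_unique[OF U _ s] by (cases x) simp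
    qed
  qed
  moreover have "?N \<epsilon> \<le> dual_norm ?V ?N ?l \<and> ?N w \<le> 1 / C_sta * dual_norm ?V ?N ?l \<and>
      ?N (j u - w) \<le> (1 + C_bnd / C_sta) * (INF z\<in>U. N\<^sub>s h (j u - z))"
    if s: "saddle_point_solution ?V U (ip h) ?b ?l \<epsilon> w" for \<epsilon> w
  proof -
    define c where "c = 1 + C_bnd / C_sta"
    have c: "0 < c" unfolding c_def using assms(16,24) by (simp add: add_pos_nonneg)
    have "?N (j u - w) \<le> c * N\<^sub>s h (j u - z)" if "z \<in> U" for z
      unfolding c_def
      by (rule saddle_point_quasi_optimal[OF U S VS assms(19) uS assms(20) assms(21,22,23,24,25) s that])
    then have "?N (j u - w) / c \<le> (INF z\<in>U. N\<^sub>s h (j u - z))"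
      using subspace_0[OF U(1)] c by (intro cINF_greatest) (auto simp: pos_divide_le_eq mult.commute)
    then have "?N (j u - w) \<le> c * (INF z\<in>U. N\<^sub>s h (j u - z))"
      using c by (simp add: pos_divide_le_eq mult.commute)
    then show ?thesis using saddle_point_bounds[OF U lf s] unfolding c_def by simp
  qed
  ultimately show ?thesis by blast
qed

end
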